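(* The two initial value problems $$\text{(a)}\quad \dot y=G(y),\quad t\in[0,\bar H],\quad y(0)=y_0:=\begin{pmatrix}x_0\\0\end{pmatrix},\qquad G(y):=\begin{pmatrix}\dfrac{f(x)}{\nabla g(x)^\top f(x)}\\[2mm] 1\end{pmatrix},$$ and $$\text{(b)}\quad \dot y=B(y)\nabla H(y),\quad t\in[0,\bar H],\quad y(0)=y_0,\qquad B(y)^\top=-B(y),$$ where $H(y):=g(x)-\omega+\bar H$, are equivalent, and possess the invariant $H(y)\equiv 0$, provided that the skew-symmetric matrix $B(y)$ is defined as follows: $$B(y)=\frac{G(y)\,\nabla H(y)^\top-\nabla H(y)\,G(y)^\top}{\|\nabla H(y)\|_2^2}.$$
   Context: Let $f:\mathbb{R}^n\to\mathbb{R}^n$ be sufficiently smooth and let $g:\mathbb{R}^n\to\mathbb{R}$ be a polynomial (or, more generally, a sufficiently smooth function). Consider the initial value problem $\frac{\mathrm{d}}{\mathrm{d}\tau}x=f(x)$, $x(0)=x_0\in\mathbb{R}^n$. It is assumed that $g(x_0)=-\bar H<0$ and that, along the solution of this problem, $\frac{\mathrm{d}}{\mathrm{d}\tau}g(x)=\nabla g(x)^\top f(x)\ge\delta>0$ for some constant $\delta$. The augmented state vector is $y=\begin{pmatrix}x\\ \omega\end{pmatrix}\in\mathbb{R}^m$, $m=n+1$, with $x\in\mathbb{R}^n$ and $\omega\in\mathbb{R}$, where $\omega=g(x(\tau))+\bar H$ is a reparametrization of time; the independent variable is $t=\omega$ and $\dot y$ denotes the derivative with respect to $t$. Vectors are columns,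 $\nabla g(x)\in\mathbb{R}^n$ and $\nabla H(y)\in\mathbb{R}^m$ are gradients, and $\|\cdot\|_2$ is the Euclidean norm. *)

theory Defs
  imports "HOL-Analysis.Analysis"
begin

definition continuously_differentiable ::
    "('a::real_normed_vector \<Rightarrow> 'b::real_normed_vector) \<Rightarrow> bool" where
  "continuously_differentiable F \<longleftrightarrow>
     (\<exists>F'. (\<forall>x. (F has_derivative blinfun_apply (F' x)) (at x)) \<and> continuous_on UNIV F')"

definition gradient :: "('a::real_inner \<Rightarrow> real) \<Rightarrow> 'a \<Rightarrow> 'a" where
  "gradient h x = (THE D. GDERIV h x :> D)"

(* "u solves u' = F u on [0,T], u(0) = u0"; the derivatives at 0 and T are one-sided. *)
definition solves_ivp ::
    "('a::real_normed_vector \<Rightarrow> 'a) \<Rightarrow> 'a \<Rightarrow> real \<Rightarrow> (real \<Rightarrow> 'a) \<Rightarrow> bool" where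
  "solves_ivp F u0 T u \<longleftrightarrow>
     u 0 = u0 \<and> (\<forall>t\<in>{0..T}. (u has_vector_derivative F (u t)) (at t within {0..T}))"

(* The space R^m, m = n + 1, is rendered with the index type 'n + 1, whose cardinality is
   CARD('n) + 1: the indices Inl i address x, the single index Inr 1 addresses omega. *)
definition augment :: "real ^ 'n \<Rightarrow> real \<Rightarrow> real ^ ('n::finite + 1)" where
  "augment x w = (\<chi> k. case k of Inl i \<Rightarrow> x $ i | Inr _ \<Rightarrow> w)"

definition x_part :: "real ^ ('n::finite + 1) \<Rightarrow> real ^ 'n" where
  "x_part y = (\<chi> i. y $ Inl i)"

definition w_part :: "real ^ ('n::finite + 1) \<Rightarrow> real" where
  "w_part y = y $ Inr 1"

(* Real division is total with a / 0 = 0, so G is also given a (meaningless) value at points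
   where the inner product of the gradient of g with f vanishes. *)
definition G_field ::
    "(real ^ 'n \<Rightarrow> real ^ 'n) \<Rightarrow> (real ^ 'n \<Rightarrow> real) \<Rightarrow> real ^ ('n::finite + 1) \<Rightarrow> real ^ ('n::finite + 1)" where
  "G_field f g y =
     augment ((1 / (gradient g (x_part y) \<bullet> f (x_part y))) *\<^sub>R f (x_part y)) 1"

definition H_fun :: "(real ^ 'n \<Rightarrow> real) \<Rightarrow> real \<Rightarrow> real ^ ('n::finite + 1) \<Rightarrow> real" where
  "H_fun g Hbar y = g (x_part y) - w_part y + Hbar"

(* The product of a column and a row vector; the inner dimension is 1. *)
definition outer :: "real ^ 'm \<Rightarrow> real ^ 'm \<Rightarrow> real ^ 'm ^ 'm" where
  "outer u v = (columnvector u :: real ^ 1 ^ 'm) ** (rowvector v :: real ^ 'm ^ 1)"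

definition B_mat ::
    "(real ^ 'n \<Rightarrow> real ^ 'n) \<Rightarrow> (real ^ 'n \<Rightarrow> real) \<Rightarrow> real \<Rightarrow> real ^ ('n::finite + 1) \<Rightarrow>
     real ^ ('n::finite + 1) ^ ('n::finite + 1)" where
  "B_mat f g Hbar y =
     (1 / (norm (gradient (H_fun g Hbar) y))\<^sup>2) *\<^sub>R
       (outer (G_field f g y) (gradient (H_fun g Hbar) y)
        - outer (gradient (H_fun g Hbar) y) (G_field f g y))"

end

theory Submission
  imports Defs
begin

text \<open>
  Since \<open>G \<bullet> \<nabla>H = 0\<close> wherever \<open>\<nabla>g \<bullet> f \<noteq> 0\<close>, the vector fields \<open>G\<close> and \<open>B \<nabla>H\<close> agree there,
  and \<open>H\<close> is constant along solutions that stay in this region.  The hypothesis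
  \<open>\<nabla>g \<bullet> f \<ge> \<delta>\<close> speaks only about solutions of \<open>x' = f x\<close>, so it has to be transported to solutions of
  the augmented problems: if \<open>\<nabla>g \<bullet> f\<close> dropped to \<open>\<delta> / 2\<close> for the first time at \<open>s\<close>, then on \<open>[0, s]\<close>
  the inverse of \<open>t \<mapsto> \<integral>\<^sub>0\<^sup>t 1 / (\<nabla>g \<bullet> f)\<close> would turn the \<open>x\<close>-part into a solution of \<open>x' = f x\<close> whose
  endpoint violates the hypothesis.
\<close>

section \<open>Gradients of differentiable functions\<close>

text \<open>\<open>gradient\<close> is a definite description, so a representing vector must exist
  and be unique. Existence comes from expanding the linear form \<open>D\<close> over the
  orthonormal basis, uniqueness from that of the derivative. The explicit sum later yields
  continuity of the gradient.\<close>

lemma has_derivative_imp_GDERIV_gradient: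
  fixes h :: "'a::euclidean_space \<Rightarrow> real"
  assumes "(h has_derivative D) (at x)"
  shows "GDERIV h x :> gradient h x" and "gradient h x = (\<Sum>b\<in>Basis. D b *\<^sub>R b)"
proof -
  interpret D: linear D
    using assms by (rule has_derivative_linear)
  have "D v = v \<bullet> (\<Sum>b\<in>Basis. D b *\<^sub>R b)" for v
  proof -
    have "D v = D (\<Sum>b\<in>Basis. (v \<bullet> b) *\<^sub>R b)"
      by (simp add: euclidean_representation)
    also have "\<dots> = v \<bullet> (\<Sum>b\<in>Basis. D b *\<^sub>R b)"
      by (simp add: D.sum D.scaleR inner_sum_right mult.commute)
    finally show ?thesis .
  qed
  then have D: "GDERIV h x :> (\<Sum>b\<in>Basis. D b *\<^sub>R b)"
    using assms unfolding gderiv_def by (metis (no_types, lifting) ext)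
  have "E = (\<Sum>b\<in>Basis. D b *\<^sub>R b)" if "GDERIV h x :> E" for E
  proof -
    have "(\<lambda>v. v \<bullet> E) = (\<lambda>v. v \<bullet> (\<Sum>b\<in>Basis. D b *\<^sub>R b))"
      using that D unfolding gderiv_def by (rule has_derivative_unique)
    then show ?thesis
      by (metis vector_eq_ldot)
  qed
  then show "gradient h x = (\<Sum>b\<in>Basis. D b *\<^sub>R b)"
    unfolding gradient_def using D by blast
  with D show "GDERIV h x :> gradient h x"
    by simp
qed

lemma gradient_eqI:
  fixes h :: "'a::euclidean_space \<Rightarrow> real"
  assumes "GDERIV h x :> D"
  shows "gradient h x = D"
proof -
  have "(h has_derivative (\<lambda>v. v \<bullet> D)) (at x)"
    using assms by (simp add: gderiv_def)
  from has_derivative_imp_GDERIV_gradient(2)[OF this] show ?thesis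
    by (simp only: inner_commute[of _ D] euclidean_representation)
qed

lemma continuously_differentiable_GDERIV:
  fixes h :: "'a::euclidean_space \<Rightarrow> real"
  assumes "continuously_differentiable h"
  shows "GDERIV h x :> gradient h x"
  using assms has_derivative_imp_GDERIV_gradient(1)
  unfolding continuously_differentiable_def by blast

lemma continuously_differentiable_continuous_gradient:
  fixes h :: "'a::euclidean_space \<Rightarrow> real"
  assumes "continuously_differentiable h"
  shows "continuous_on UNIV (gradient h)"
proof -
  obtain h' where h': "\<And>x. (h has_derivative blinfun_apply (h' x)) (at x)"
    and cont: "continuous_on UNIV h'"
    using assms unfolding continuously_differentiable_def by blast
  have "gradient h = (\<lambda>x. \<Sum>b\<in>Basis. blinfun_apply (h' x) b *\<^sub>R b)"
    using has_derivative_imp_GDERIV_gradient(2)[OF h'] by blast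
  then show ?thesis
    by (simp add: cont continuous_intros)
qed

lemma continuously_differentiable_continuous:
  assumes "continuously_differentiable F"
  shows "continuous_on UNIV F"
  using assms unfolding continuously_differentiable_def
  by (metis has_derivative_continuous continuous_at_imp_continuous_on)

section \<open>Augmented vectors and the gradient of \<open>H_fun\<close>\<close>

lemma x_part_augment [simp]: "x_part (augment x w) = x"
  by (simp add: x_part_def augment_def vec_eq_iff)

lemma w_part_augment [simp]: "w_part (augment x w) = w"
  by (simp add: w_part_def augment_def)

lemma inner_augment: "y \<bullet> augment x w = x_part y \<bullet> x + w_part y * w"
proof -
  have "y \<bullet> augment x w = (\<Sum>k\<in>UNIV <+> UNIV. y $ k * augment x w $ k)"
    by (simp only: UNIV_Plus_UNIV inner_vec_def inner_real_def)
  also have "\<dots> = x_part y \<bullet> x + w_part y * w"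
    by (subst sum.Plus)
      (auto simp: inner_vec_def x_part_def w_part_def augment_def UNIV_1)
  finally show ?thesis .
qed

lemma bounded_linear_x_part: "bounded_linear x_part"
  unfolding linear_conv_bounded_linear [symmetric]
  by (rule linearI) (simp_all add: x_part_def vec_eq_iff)

lemma bounded_linear_w_part: "bounded_linear w_part"
  unfolding linear_conv_bounded_linear [symmetric]
  by (rule linearI) (simp_all add: w_part_def)

lemma GDERIV_H_fun:
  assumes "continuously_differentiable g"
  shows "GDERIV (H_fun g Hbar) y :> augment (gradient g (x_part y)) (- 1)"
proof -
  have g: "(g has_derivative (\<lambda>v. v \<bullet> gradient g (x_part y))) (at (x_part y))"
    using continuously_differentiable_GDERIV[OF assms] by (simp add: gderiv_def)
  note x = bounded_linear_imp_has_derivative[OF bounded_linear_x_part, of "at y"]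
  note w = bounded_linear_imp_has_derivative[OF bounded_linear_w_part, of "at y"]
  have "((\<lambda>y. g (x_part y) - w_part y + Hbar) has_derivative
      (\<lambda>v. x_part v \<bullet> gradient g (x_part y) - w_part v + 0)) (at y)"
    by (intro has_derivative_add has_derivative_diff has_derivative_const w
        has_derivative_compose[OF x g])
  then show ?thesis
    by (simp add: gderiv_def inner_augment H_fun_def[abs_def])
qed

lemma gradient_H_fun:
  assumes "continuously_differentiable g"
  shows "gradient (H_fun g Hbar) y = augment (gradient g (x_part y)) (- 1)"
  using assms by (intro gradient_eqI GDERIV_H_fun)

text \<open>The x-part contributes the denominator divided by itself, which is 1, and the omega
  component contributes -1. Where the denominator vanishes, division by zero gives 0 and the inner
  product would be -1.\<close>

lemma G_field_inner_gradient_H_fun: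
  assumes "continuously_differentiable g"
    and "gradient g (x_part y) \<bullet> f (x_part y) \<noteq> 0"
  shows "G_field f g y \<bullet> gradient (H_fun g Hbar) y = 0"
  using assms by (simp add: gradient_H_fun inner_augment G_field_def inner_commute)

section \<open>The skew-symmetric matrix\<close>

lemma outer_mult_vector: "outer u v *v z = (v \<bullet> z) *\<^sub>R u"
  by (simp add: vec_eq_iff outer_def matrix_matrix_mult_def matrix_vector_mult_def
      columnvector_def rowvector_def inner_vec_def sum_distrib_left mult_ac)

lemma transpose_outer: "transpose (outer u v) = outer v u"
  by (simp add: outer_def matrix_transpose_mul transpose_columnvector transpose_rowvector)

lemma transpose_B_mat: "transpose (B_mat f g Hbar y) = - B_mat f g Hbar y"
proof -
  have diff: "transpose (A - C) = transpose A - transpose C" for A C :: "real ^ 'm ^ 'm"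
    by (simp add: transpose_def vec_eq_iff)
  show ?thesis
    unfolding B_mat_def by (simp add: transpose_scalar transpose_outer diff algebra_simps)
qed

text \<open>Applied to the gradient of \<open>H_fun\<close>, the first outer product gives the
  squared norm times \<open>G_field\<close>, which the prefactor normalises; the second gives a
  multiple of \<open>G_field \<bullet> gradient\<close>, which is zero.\<close>

lemma B_mat_mult_gradient_H_fun:
  assumes "continuously_differentiable g"
    and "gradient g (x_part y) \<bullet> f (x_part y) \<noteq> 0"
  shows "B_mat f g Hbar y *v gradient (H_fun g Hbar) y = G_field f g y"
proof -
  let ?N = "gradient (H_fun g Hbar) y"
  \<comment> \<open>The omega component keeps the gradient nonzero everywhere, so the normalisation
    in \<open>B_mat\<close> is a genuine division.\<close>
  have "w_part ?N = - 1"
    by (simp add: gradient_H_fun[OF assms(1)])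
  then have "?N \<noteq> 0"
    by (auto simp: w_part_def)
  then show ?thesis
    using G_field_inner_gradient_H_fun[of g y f, OF assms, of Hbar]
    unfolding B_mat_def
    by (simp add: scaleR_matrix_vector_assoc [symmetric] matrix_vector_mult_diff_rdistrib
        outer_mult_vector power2_norm_eq_inner)
qed

section \<open>Change of time scale\<close>

text \<open>The inverse \<open>\<psi>\<close> of an antiderivative \<open>\<phi>\<close> of
  \<open>1 / q\<close> has derivative \<open>q\<close>, which cancels the factor
  \<open>1 / q\<close> in the chain rule for \<open>x \<circ> \<psi>\<close>.\<close>

lemma time_rescaled_solution:
  fixes x :: "real \<Rightarrow> 'a::real_normed_vector"
  assumes "0 \<le> T" and q: "continuous_on {0..T} q" and pos: "\<And>t. t \<in> {0..T} \<Longrightarrow> 0 < q t"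
    and x: "\<And>t. t \<in> {0..T} \<Longrightarrow>
      (x has_vector_derivative (1 / q t) *\<^sub>R f (x t)) (at t within {0..T})"
  obtains S X where "0 \<le> S" "solves_ivp f (x 0) S X" "X S = x T"
proof -
  define c where "c t = max 0 (min T t)" for t :: real
  have c: "c t \<in> {0..T}" for t
    using \<open>0 \<le> T\<close> by (auto simp: c_def)
  have c_id: "c t = t" if "t \<in> {0..T}" for t
    using that by (auto simp: c_def)
  \<comment> \<open>Extending the integrand beyond \<open>[0, T]\<close> makes the inverse function theorem for open sets
    applicable at the endpoints as well.\<close>
  have "continuous_on {-1..T+1} (\<lambda>t. 1 / q (c t))"
  proof (intro continuous_on_divide continuous_on_const ballI)
    show "continuous_on {-1..T+1} (\<lambda>t. q (c t))"
      by (rule continuous_on_compose2[OF q]) (use c in \<open>auto simp: c_def intro!: continuous_intros\<close>)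
    show "q (c t) \<noteq> 0" for t
      using pos[OF c] by (metis less_irrefl)
  qed
  then obtain \<phi> where \<phi>:
      "\<And>t. t \<in> {-1..T+1} \<Longrightarrow> (\<phi> has_vector_derivative 1 / q (c t)) (at t within {-1..T+1})"
    by (rule antiderivative_continuous) (rule that)
  define I where "I = {-1<..<T+1}"
  have \<phi>': "DERIV \<phi> t :> 1 / q (c t)" if "t \<in> I" for t
  proof -
    have "(\<phi> has_vector_derivative 1 / q (c t)) (at t within I)"
      by (rule has_vector_derivative_within_subset[OF \<phi>]) (use that in \<open>auto simp: I_def\<close>)
    then show ?thesis
      using that by (simp add: I_def at_within_open[OF _ open_greaterThanLessThan]
          has_real_derivative_iff_has_vector_derivative)
  qed
  have cont: "continuous_on I \<phi>"
    using \<phi>' by (meson DERIV_isCont continuous_at_imp_continuous_on)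
  have less: "\<phi> s < \<phi> t" if "s \<in> I" "t \<in> I" "s < t" for s t
  proof (rule DERIV_pos_imp_increasing_open[OF \<open>s < t\<close>])
    show "\<exists>y. DERIV \<phi> r :> y \<and> y > 0" if "s < r" "r < t" for r
      using \<phi>'[of r] pos[OF c, of r] that \<open>s \<in> I\<close> \<open>t \<in> I\<close> by (force simp: I_def)
    show "continuous_on {s..t} \<phi>"
      by (rule continuous_on_subset[OF cont]) (use that in \<open>auto simp: I_def\<close>)
  qed
  then have inj: "inj_on \<phi> I"
    by (metis linorder_inj_onI' less_irrefl)
  define \<psi> where "\<psi> = inv_into I \<phi>"
  have \<psi>: "\<psi> (\<phi> t) = t" if "t \<in> I" for t
    using inj that by (simp add: \<psi>_def)
  have \<psi>': "DERIV \<psi> (\<phi> t) :> q t" if t: "t \<in> {0..T}" for t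
  proof -
    have "t \<in> I"
      using t by (auto simp: I_def)
    show ?thesis
      unfolding has_field_derivative_def
    proof (rule has_derivative_inverse_strong[OF _ \<open>t \<in> I\<close> cont \<psi>])
      show "open I"
        by (simp add: I_def)
      show "(\<phi> has_derivative (*) (1 / q t)) (at t)"
        using \<phi>'[OF \<open>t \<in> I\<close>] by (simp only: has_field_derivative_def c_id[OF t])
      show "(*) (1 / q t) \<circ> (*) (q t) = id"
        using pos[OF t] by (auto simp: fun_eq_iff)
    qed
  qed
  have sub: "{0..T} \<subseteq> I"
    by (auto simp: I_def)
  \<comment> \<open>The antiderivative is fixed only up to a constant, so the new time is counted
    from \<open>\<phi> 0\<close>.\<close>
  define S where "S = \<phi> T - \<phi> 0"
  define X where "X s = x (\<psi> (\<phi> 0 + s))" for s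
  have S: "0 \<le> S"
    using less[of 0 T] \<open>0 \<le> T\<close> by (cases "T = 0") (auto simp: S_def I_def)
  \<comment> \<open>The derivative of \<open>\<psi>\<close> is known only at values of
    \<open>\<phi>\<close>; by the intermediate value theorem these cover the whole new time
    interval.\<close>
  have reach: "\<exists>t\<in>{0..T}. \<phi> 0 + s = \<phi> t" if "s \<in> {0..S}" for s
    using IVT'[of \<phi> 0 "\<phi> 0 + s" T] that \<open>0 \<le> T\<close> continuous_on_subset[OF cont sub]
    by (force simp: S_def)
  have "solves_ivp f (x 0) S X"
    unfolding solves_ivp_def
  proof (intro conjI ballI)
    show "X 0 = x 0"
      using \<psi>[of 0] sub \<open>0 \<le> T\<close> by (auto simp: X_def)
    fix s assume s: "s \<in> {0..S}"
    then obtain t where t: "t \<in> {0..T}" "\<phi> 0 + s = \<phi> t"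
      using reach by blast
    have inner: "((\<lambda>s. \<psi> (\<phi> 0 + s)) has_vector_derivative q t) (at s within {0..S})"
    proof -
      have "((\<lambda>s. \<phi> 0 + s) has_field_derivative 1) (at s)"
        by (auto intro!: derivative_eq_intros)
      moreover have "DERIV \<psi> (\<phi> 0 + s) :> q t"
        using \<psi>'[OF t(1)] t(2) by simp
      ultimately have "DERIV (\<lambda>s. \<psi> (\<phi> 0 + s)) s :> q t * 1"
        by (intro DERIV_chain2)
      then show ?thesis
        by (simp add: has_real_derivative_iff_has_vector_derivative has_vector_derivative_at_within)
    qed
    have \<psi>s: "\<psi> (\<phi> 0 + s) = t"
      using t \<psi> sub by auto
    \<comment> \<open>The derivative of \<open>x\<close> is known only relative to
      \<open>{0..T}\<close>, so the chain rule requires the rescaled time to stay in that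
      interval.\<close>
    have "(\<lambda>s. \<psi> (\<phi> 0 + s)) ` {0..S} \<subseteq> {0..T}"
    proof (rule image_subsetI)
      fix s assume "s \<in> {0..S}"
      then obtain t where "t \<in> {0..T}" "\<phi> 0 + s = \<phi> t"
        using reach by blast
      moreover from this(1) have "\<psi> (\<phi> t) = t"
        using \<psi> sub by blast
      ultimately show "\<psi> (\<phi> 0 + s) \<in> {0..T}"
        by simp
    qed
    then have "(x has_vector_derivative (1 / q t) *\<^sub>R f (x t))
        (at (\<psi> (\<phi> 0 + s)) within (\<lambda>s. \<psi> (\<phi> 0 + s)) ` {0..S})"
      using has_vector_derivative_within_subset[OF x[OF t(1)]] \<psi>s by simp
    from vector_diff_chain_within[OF inner this]
    show "(X has_vector_derivative f (X s)) (at s within {0..S})"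
      using pos[OF t(1)] \<psi>s by (simp add: X_def[abs_def] o_def)
  qed
  moreover have "X S = x T"
    using \<psi>[of T] sub \<open>0 \<le> T\<close> by (auto simp: X_def S_def)
  ultimately show thesis
    using S that by blast
qed

section \<open>Transversality along solutions\<close>

text \<open>The set where \<open>p \<le> a\<close> is closed, so its infimum is attained; before it
  \<open>p\<close> exceeds \<open>a\<close>, and the intermediate value theorem forces equality
  there.\<close>

lemma first_hitting_time:
  fixes p :: "real \<Rightarrow> real"
  assumes "continuous_on {0..T} p" "a < p 0" "t \<in> {0..T}" "p t \<le> a"
  obtains s where "s \<in> {0..T}" "p s = a" "\<And>r. r \<in> {0..s} \<Longrightarrow> a \<le> p r"
proof -
  define A where "A = {r \<in> {0..T}. p r \<in> {..a}}"
  have "A = {0..T} \<inter> p -` {..a}"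
    by (auto simp: A_def)
  then have "closed A"
    using continuous_closed_preimage[OF assms(1), of "{..a}"] by simp
  have ne: "A \<noteq> {}"
    using assms(3,4) by (auto simp: A_def)
  have bdd: "bdd_below A"
    by (rule bdd_belowI[of _ 0]) (auto simp: A_def)
  define s where "s = Inf A"
  have s: "s \<in> A"
    unfolding s_def using closed_contains_Inf[OF ne bdd \<open>closed A\<close>] .
  have above: "a < p r" if "r \<in> {0..<s}" for r
  proof (rule ccontr)
    assume "\<not> ?thesis"
    then have "r \<in> A"
      using that s by (auto simp: A_def)
    then show False
      using cInf_lower[OF _ bdd] that by (force simp: s_def)
  qed
  have "p s = a"
  proof (rule ccontr)
    assume "p s \<noteq> a"
    then have "p s < a"
      using s by (auto simp: A_def)
    moreover have "continuous_on {0..s} p"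
      by (rule continuous_on_subset[OF assms(1)]) (use s in \<open>auto simp: A_def\<close>)
    ultimately obtain r where "0 \<le> r" "r \<le> s" "p r = a"
      using IVT2'[of p s a 0] assms(2) s by (auto simp: A_def)
    then show False
      using above[of r] \<open>p s < a\<close> by (cases "r = s") auto
  qed
  show thesis
  proof (rule that[of s])
    show "s \<in> {0..T}" "p s = a"
      using s \<open>p s = a\<close> by (auto simp: A_def)
    show "a \<le> p r" if "r \<in> {0..s}" for r
      using above[of r] \<open>p s = a\<close> that by (cases "r = s") auto
  qed
qed

text \<open>\<open>F\<close> is tied to \<open>G_field\<close> only where the denominator is
  nonzero, so one argument covers both problems. The level \<open>\<delta> / 2\<close> is positive,
  which keeps the quotient meaningful up to and including the hitting time, and lies below
  \<open>\<delta>\<close>, which gives the contradiction.\<close>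

lemma solution_keeps_transversality:
  fixes f :: "real ^ 'n \<Rightarrow> real ^ 'n" and g :: "real ^ 'n \<Rightarrow> real"
  assumes cf: "continuous_on UNIV f" and cg: "continuous_on UNIV (gradient g)"
    and "\<delta> > 0"
    and lower: "\<And>x T \<tau>. solves_ivp f x0 T x \<Longrightarrow> \<tau> \<in> {0..T} \<Longrightarrow>
      gradient g (x \<tau>) \<bullet> f (x \<tau>) \<ge> \<delta>"
    and F: "\<And>z. gradient g (x_part z) \<bullet> f (x_part z) \<noteq> 0 \<Longrightarrow> F z = G_field f g z"
    and y: "solves_ivp F (augment x0 0) T y"
    and t: "t \<in> {0..T}"
  shows "gradient g (x_part (y t)) \<bullet> f (x_part (y t)) > \<delta> / 2"
proof (rule ccontr)
  define x where "x t = x_part (y t)" for t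
  define p where "p t = gradient g (x t) \<bullet> f (x t)" for t
  assume "\<not> ?thesis"
  then have "p t \<le> \<delta> / 2"
    by (simp add: p_def x_def)
  have x0: "x 0 = x0"
    using y by (simp add: x_def solves_ivp_def)
  have x': "(x has_vector_derivative x_part (F (y t))) (at t within {0..T})" if "t \<in> {0..T}" for t
    unfolding x_def
    using y that by (intro bounded_linear.has_vector_derivative[OF bounded_linear_x_part])
      (auto simp: solves_ivp_def)
  then have "continuous_on {0..T} x"
    by (meson has_vector_derivative_continuous continuous_on_eq_continuous_within)
  then have p: "continuous_on {0..T} p"
    unfolding p_def
    by (intro continuous_on_inner continuous_on_compose2[OF cf] continuous_on_compose2[OF cg]) auto
  \<comment> \<open>On the degenerate interval \<open>{0..0}\<close> the derivative condition is
    vacuous, so the constant function makes \<open>lower\<close> applicable at \<open>x0\<close>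
    itself.\<close>
  have "solves_ivp f x0 0 (\<lambda>_. x0)"
    by (auto simp: solves_ivp_def has_vector_derivative_def
        has_derivative_within_singleton_iff bounded_linear_scaleR_left)
  then have "p 0 \<ge> \<delta>"
    using lower[of 0 "\<lambda>_. x0" 0] x0 by (simp add: p_def)
  then have "\<delta> / 2 < p 0"
    using \<open>\<delta> > 0\<close> by simp
  then obtain s where s: "s \<in> {0..T}" "p s = \<delta> / 2" "\<And>r. r \<in> {0..s} \<Longrightarrow> \<delta> / 2 \<le> p r"
    using first_hitting_time[OF p _ t] \<open>p t \<le> \<delta> / 2\<close> by metis
  have sub: "{0..s} \<subseteq> {0..T}"
    using s(1) by auto
  have pos: "0 < p r" if "r \<in> {0..s}" for r
    using s(3)[OF that] \<open>\<delta> > 0\<close> by simp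
  \<comment> \<open>Up to \<open>s\<close> the denominator is positive, so \<open>F\<close>
    coincides with \<open>G_field\<close> along \<open>y\<close> and the time change applies with
    \<open>q = p\<close>.\<close>
  have "(x has_vector_derivative (1 / p r) *\<^sub>R f (x r)) (at r within {0..s})"
    if r: "r \<in> {0..s}" for r
  proof -
    have "x_part (F (y r)) = (1 / p r) *\<^sub>R f (x r)"
      using F[of "y r"] pos[OF r] by (simp add: G_field_def p_def x_def)
    then show ?thesis
      using has_vector_derivative_within_subset[OF x' sub, of r] r sub by auto
  qed
  then obtain S X where "0 \<le> S" "solves_ivp f x0 S X" "X S = x s"
    using time_rescaled_solution[of s p x f] s(1) continuous_on_subset[OF p sub] pos x0 by auto
  then have "p s \<ge> \<delta>"
    using lower[of S X S] by (simp add: p_def)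
  then show False
    using s(2) \<open>\<delta> > 0\<close> by simp
qed

section \<open>Invariance of \<open>H_fun\<close> and equivalence of the two problems\<close>

lemma solves_ivp_cong:
  assumes "\<And>t. t \<in> {0..T} \<Longrightarrow> F (u t) = F' (u t)"
  shows "solves_ivp F u0 T u \<longleftrightarrow> solves_ivp F' u0 T u"
  using assms by (simp add: solves_ivp_def)

text \<open>By the chain rule the derivative of \<open>H_fun\<close> along \<open>y\<close> is the
  inner product of \<open>G_field\<close> with the gradient, which is zero; the constant is read off
  at time 0 as \<open>g x0 - 0 + Hbar\<close>.\<close>

lemma H_fun_eq_0_along_solution:
  assumes g: "continuously_differentiable g" and "g x0 = - Hbar"
    and nz: "\<And>t. t \<in> {0..T} \<Longrightarrow> gradient g (x_part (y t)) \<bullet> f (x_part (y t)) \<noteq> 0"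
    and y: "solves_ivp (G_field f g) (augment x0 0) T y"
    and t: "t \<in> {0..T}"
  shows "H_fun g Hbar (y t) = 0"
proof -
  have "((\<lambda>t. H_fun g Hbar (y t)) has_derivative (\<lambda>h. 0)) (at t within {0..T})"
    if t: "t \<in> {0..T}" for t
  proof -
    have "(y has_derivative (\<lambda>h. h *\<^sub>R G_field f g (y t))) (at t within {0..T})"
      using y t by (simp add: solves_ivp_def has_vector_derivative_def)
    moreover have "(H_fun g Hbar has_derivative (\<lambda>v. v \<bullet> gradient (H_fun g Hbar) (y t))) (at (y t))"
      using GDERIV_H_fun[OF g, of Hbar "y t"] gradient_H_fun[OF g, of Hbar "y t"]
      by (simp add: gderiv_def)
    ultimately have "((\<lambda>t. H_fun g Hbar (y t)) has_derivative
        (\<lambda>h. (h *\<^sub>R G_field f g (y t)) \<bullet> gradient (H_fun g Hbar) (y t))) (at t within {0..T})"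
      by (rule has_derivative_compose)
    then show ?thesis
      using G_field_inner_gradient_H_fun[of g "y t" f, OF g nz[OF t], of Hbar] by simp
  qed
  from has_derivative_zero_constant[OF convex_closed_interval this]
  obtain k where k: "\<And>t. t \<in> {0..T} \<Longrightarrow> H_fun g Hbar (y t) = k"
    by blast
  have "y 0 = augment x0 0"
    using y by (simp add: solves_ivp_def)
  then have "H_fun g Hbar (y 0) = 0"
    using \<open>g x0 = - Hbar\<close> by (simp add: H_fun_def)
  moreover have "0 \<in> {0..T}"
    using t by simp
  ultimately show ?thesis
    using k t by metis
qed

theorem theorem1:
  fixes f :: "real ^ 'n \<Rightarrow> real ^ 'n"
    and g :: "real ^ 'n \<Rightarrow> real"
    and x0 :: "real ^ 'n"
    and Hbar \<delta> :: real
  assumes "continuously_differentiable f"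
    and "continuously_differentiable g"
    and "g x0 = - Hbar" and "- Hbar < 0"
    and "\<delta> > 0"
    and "\<And>x T \<tau>. solves_ivp f x0 T x \<Longrightarrow> \<tau> \<in> {0..T} \<Longrightarrow>
           gradient g (x \<tau>) \<bullet> f (x \<tau>) \<ge> \<delta>"
  shows "(\<forall>y. transpose (B_mat f g Hbar y) = - B_mat f g Hbar y)
    \<and> (\<forall>y. solves_ivp (G_field f g) (augment x0 0) Hbar y
           \<longleftrightarrow> solves_ivp (\<lambda>z. B_mat f g Hbar z *v gradient (H_fun g Hbar) z) (augment x0 0) Hbar y)
    \<and> (\<forall>y. solves_ivp (G_field f g) (augment x0 0) Hbar y
           \<longrightarrow> (\<forall>t\<in>{0..Hbar}. H_fun g Hbar (y t) = 0))
    \<and> (\<forall>y. solves_ivp (\<lambda>z. B_mat f g Hbar z *v gradient (H_fun g Hbar) z) (augment x0 0) Hbar y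
           \<longrightarrow> (\<forall>t\<in>{0..Hbar}. H_fun g Hbar (y t) = 0))"
proof -
  let ?BH = "\<lambda>z. B_mat f g Hbar z *v gradient (H_fun g Hbar) z"
  let ?a = "solves_ivp (G_field f g) (augment x0 0) Hbar"
  let ?b = "solves_ivp ?BH (augment x0 0) Hbar"
  have BH: "?BH z = G_field f g z" if "gradient g (x_part z) \<bullet> f (x_part z) \<noteq> 0" for z
    using B_mat_mult_gradient_H_fun[of g z f, OF assms(2) that] .
  \<comment> \<open>Solving either problem suffices: for the second one, \<open>BH\<close> supplies
    the required agreement with \<open>G_field\<close>.\<close>
  have nz: "gradient g (x_part (y t)) \<bullet> f (x_part (y t)) \<noteq> 0"
    if "?a y \<or> ?b y" and t: "t \<in> {0..Hbar}" for y t
  proof -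
    have "gradient g (x_part (y t)) \<bullet> f (x_part (y t)) > \<delta> / 2"
      if "solves_ivp F (augment x0 0) Hbar y"
        and "\<And>z. gradient g (x_part z) \<bullet> f (x_part z) \<noteq> 0 \<Longrightarrow> F z = G_field f g z" for F
      by (rule solution_keeps_transversality[of f g \<delta> x0 F Hbar y])
        (use t in \<open>simp_all add: assms(5,6) that
          continuously_differentiable_continuous[OF assms(1)]
          continuously_differentiable_continuous_gradient[OF assms(2)]\<close>)
    from this[of "G_field f g"] this[of ?BH]
    have "gradient g (x_part (y t)) \<bullet> f (x_part (y t)) > \<delta> / 2"
      using \<open>?a y \<or> ?b y\<close> BH by blast
    then show ?thesis
      using assms(5) by simp
  qed
  have equiv: "?a y \<longleftrightarrow> ?b y" for y
  \<comment> \<open>If \<open>y\<close> solves neither problem, the equivalence is trivial;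
    otherwise \<open>nz\<close> places \<open>y\<close> in the region where the two fields
    agree.\<close>
  proof (cases "?a y \<or> ?b y")
    case True
    then show ?thesis
      using BH nz by (intro solves_ivp_cong) simp
  qed simp
  have inv: "H_fun g Hbar (y t) = 0" if "?a y" "t \<in> {0..Hbar}" for y t
    using H_fun_eq_0_along_solution[OF assms(2,3) _ that] nz that(1) by blast
  \<comment> \<open>The invariant of the second problem is inherited from the first through
    \<open>equiv\<close>.\<close>
  show ?thesis
    using transpose_B_mat equiv inv by blast
qed

end
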